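(* Let $m\in\mathbb{N}$. For all functions $f$ and $g$ in $RI(\mathbb{R}^{m})$ and for all real constants $\alpha$ and $\beta$, the function $\alpha f+\beta g$ is an element of $RI(\mathbb{R}^{m})$ and $$\int_{\mathbb{R}^{m}}(\alpha f+\beta g)=\alpha\int_{\mathbb{R}^{m}}f+\beta\int_{\mathbb{R}^{m}}g .$$
   Context: For $m\in\mathbb{N}=\{1,2,\dots\}$ and an integer $k\ge 0$, $D_{k}(\mathbb{R}^{m})$ is the collection of all semiclosed dyadic cubes $\prod_{j=1}^{m}[n_{j}2^{-k},(n_{j}+1)2^{-k})$ with $n_{1},\dots,n_{m}\in\mathbb{Z}$. $BB(\mathbb{R}^{m})$ is the set of bounded functions $f:\mathbb{R}^{m}\to\mathbb{R}$ which vanish outside some bounded set. For $f\in BB(\mathbb{R}^{m})$ set $U_{k}(f)=2^{-km}\sum_{I\in D_{k}(\mathbb{R}^{m})}\sup_{p\in I}f(p)$ and $L_{k}(f)=2^{-km}\sum_{I\in D_{k}(\mathbb{R}^{m})}\inf_{p\in I}f(p)$ (only finitely many terms are non-zero). The sequences $U_k(f)$ and $L_k(f)$ are bounded and, respectively, non-increasing and non-decreasing in $k$, so they converge. A function $f\in BB(\mathbb{R}^{m})$ is (dyadically) Riemann integrable, written $f\in RI(\mathbb{R}^{m})$, if $\lim_{k\to\infty}U_{k}(f)=\lim_{k\to\infty}L_{k}(f)$; the common value is denoted $\int_{\mathbb{R}^{m}}f$. *)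

theory Defs
  imports "HOL-Analysis.Analysis"
begin

(* The dimension m >= 1 is CARD('m); the index type 'm replaces {1,...,m}. *)

definition dyadic_cube :: "nat \<Rightarrow> int ^ 'm \<Rightarrow> (real ^ 'm) set" where
  "dyadic_cube k n =
     {p. \<forall>j. p $ j \<in> {real_of_int (n $ j) * (1/2) ^ k ..< (real_of_int (n $ j) + 1) * (1/2) ^ k}}"

definition dyadic_cubes :: "nat \<Rightarrow> (real ^ 'm) set set" where
  "dyadic_cubes k = range (dyadic_cube k)"

definition BB :: "(real ^ 'm \<Rightarrow> real) set" where
  "BB = {f. bounded (range f) \<and> (\<exists>S. bounded S \<and> (\<forall>x. x \<notin> S \<longrightarrow> f x = 0))}"

(* For f in BB only finitely many terms of the two sums below are nonzero, so the
   unconditional sums over the infinite set of cubes are just finite sums of those terms. *)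

definition upper_sum :: "nat \<Rightarrow> (real ^ 'm \<Rightarrow> real) \<Rightarrow> real" where
  "upper_sum k f = (1/2) ^ (k * CARD('m)) * (\<Sum>\<^sub>\<infinity>I\<in>dyadic_cubes k. (SUP p\<in>I. f p))"

definition lower_sum :: "nat \<Rightarrow> (real ^ 'm \<Rightarrow> real) \<Rightarrow> real" where
  "lower_sum k f = (1/2) ^ (k * CARD('m)) * (\<Sum>\<^sub>\<infinity>I\<in>dyadic_cubes k. (INF p\<in>I. f p))"

(* For f in BB both sequences are bounded and monotone, so both limits exist. *)

definition RI :: "(real ^ 'm \<Rightarrow> real) set" where
  "RI = {f \<in> BB. lim (\<lambda>k. upper_sum k f) = lim (\<lambda>k. lower_sum k f)}"

definition dyadic_integral :: "(real ^ 'm \<Rightarrow> real) \<Rightarrow> real" where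
  "dyadic_integral f = lim (\<lambda>k. upper_sum k f)"

end

theory Submission
  imports Defs
begin

text \<open>
  Two facts about bounded functions of bounded support carry the theorem.

  The upper sum is sublinear in the function: on each cube the supremum of
  \<open>a * f + b * g\<close> with \<open>a, b \<ge> 0\<close> is at most \<open>a\<close> times the supremum of \<open>f\<close> plus
  \<open>b\<close> times the supremum of \<open>g\<close>. The lower sum of \<open>f\<close> is minus the upper sum of \<open>- f\<close>,
  so lower sums are superlinear. When \<open>f\<close> and \<open>g\<close> are integrable, the upper and lower sums of
  \<open>a * f + b * g\<close> therefore lie between two sequences with the common limit
  \<open>a * \<integral>f + b * \<integral>g\<close>. The same duality exchanges the limits of upper and lower sums of \<open>- f\<close>,
  which makes \<open>- f\<close> integrable with integral \<open>- \<integral>f\<close>; a negative coefficient is handled by moving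
  its sign into the function.

  The squeeze needs the upper and lower sums of \<open>f\<close> and \<open>g\<close> to converge, whereas integrability
  speaks only of \<open>lim\<close>, which is an unspecified number for a divergent sequence. Convergence
  follows from monotonicity: a cube of level \<open>k\<close> is split into \<open>2 ^ m\<close> cubes of level
  \<open>k + 1\<close>, each of which has \<open>2 ^ -m\<close> times its volume and a supremum that is no larger.
\<close>

section \<open>Dyadic cubes\<close>

text \<open>This floor description makes the cubes of one level the fibres of a map onto the integer
  vectors, which yields nonemptiness, disjointness and refinement.\<close>

lemma mem_dyadic_cube_iff:
  "p \<in> dyadic_cube k n \<longleftrightarrow> (\<forall>j. \<lfloor>2 ^ k * p $ j\<rfloor> = n $ j)"
proof -
  have "(x \<in> {real_of_int z * (1/2) ^ k ..< (real_of_int z + 1) * (1/2) ^ k})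
        = (\<lfloor>2 ^ k * x\<rfloor> = z)" for x :: real and z :: int
    by (simp add: floor_eq_iff power_divide field_simps)
  then show ?thesis
    by (simp add: dyadic_cube_def)
qed

lemma dyadic_cube_nonempty: "dyadic_cube k n \<noteq> {}"
proof -
  have "(\<chi> j. real_of_int (n $ j) / 2 ^ k) \<in> dyadic_cube k n"
    by (simp add: mem_dyadic_cube_iff)
  then show ?thesis by blast
qed

lemma inj_dyadic_cube: "inj (dyadic_cube k :: int ^ 'm \<Rightarrow> _)"
proof (rule injI)
  fix n n' :: "int ^ 'm"
  assume eq: "dyadic_cube k n = dyadic_cube k n'"
  obtain p where "p \<in> dyadic_cube k n"
    using dyadic_cube_nonempty by blast
  with eq show "n = n'"
    by (metis mem_dyadic_cube_iff vec_eq_iff)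
qed

lemma finite_int_vectors_in_box: "finite {n :: int ^ 'm. \<forall>j. \<bar>n $ j\<bar> \<le> N}"
proof -
  have "finite (vec_lambda ` (PiE UNIV (\<lambda>_. {-N..N})) :: (int ^ 'm) set)"
    by (intro finite_imageI finite_PiE) auto
  moreover have "{n :: int ^ 'm. \<forall>j. \<bar>n $ j\<bar> \<le> N} \<subseteq> vec_lambda ` (PiE UNIV (\<lambda>_. {-N..N}))"
  proof
    fix n :: "int ^ 'm"
    assume "n \<in> {n. \<forall>j. \<bar>n $ j\<bar> \<le> N}"
    then have "- N \<le> n $ j \<and> n $ j \<le> N" for j
      by (metis (mono_tags) abs_le_iff mem_Collect_eq minus_le_iff)
    then have "vec_nth n \<in> PiE UNIV (\<lambda>_. {-N..N})"
      by auto
    then show "n \<in> vec_lambda ` (PiE UNIV (\<lambda>_. {-N..N}))"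
      by (metis image_eqI vec_nth_inverse)
  qed
  ultimately show ?thesis
    by (rule finite_subset[rotated])
qed

lemma finite_dyadic_cubes_meeting_bounded:
  fixes S :: "(real ^ 'm) set"
  assumes "bounded S"
  shows "finite {n :: int ^ 'm. dyadic_cube k n \<inter> S \<noteq> {}}"
proof -
  obtain B where B: "\<And>x. x \<in> S \<Longrightarrow> norm x \<le> B"
    using assms by (auto simp: bounded_iff)
  have "\<bar>n $ j\<bar> \<le> \<lceil>2 ^ k * B\<rceil> + 1" if p: "p \<in> dyadic_cube k n" "p \<in> S"
    for n :: "int ^ 'm" and p j
  proof -
    have "\<bar>p $ j\<bar> \<le> B"
      using B[OF p(2)] component_le_norm_cart[of p j] by linarith
    then have "\<bar>2 ^ k * p $ j\<bar> \<le> 2 ^ k * B"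
      by (simp add: abs_mult)
    moreover have "\<lfloor>2 ^ k * p $ j\<rfloor> = n $ j"
      using p(1) by (simp add: mem_dyadic_cube_iff)
    ultimately show ?thesis
      by linarith
  qed
  then have "{n :: int ^ 'm. dyadic_cube k n \<inter> S \<noteq> {}} \<subseteq> {n. \<forall>j. \<bar>n $ j\<bar> \<le> \<lceil>2 ^ k * B\<rceil> + 1}"
    by blast
  then show ?thesis
    by (rule finite_subset[OF _ finite_int_vectors_in_box])
qed

text \<open>The bit vector \<open>e\<close> selects, in each coordinate, the lower or the upper half of the cube
  with index \<open>n\<close>.\<close>

definition dyadic_child :: "(int ^ 'm) \<times> (bool ^ 'm) \<Rightarrow> int ^ 'm" where
  "dyadic_child = (\<lambda>(n, e). \<chi> j. 2 * n $ j + of_bool (e $ j))"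

text \<open>Division by 2 with remainder in each coordinate: every cube of level \<open>k + 1\<close> has
  exactly one parent.\<close>

lemma bij_dyadic_child: "bij (dyadic_child :: (int ^ 'm) \<times> (bool ^ 'm) \<Rightarrow> _)"
proof (rule bij_betwI[where g = "\<lambda>n. (\<chi> j. n $ j div 2, \<chi> j. odd (n $ j))"])
  fix x :: "(int ^ 'm) \<times> (bool ^ 'm)"
  show "(\<lambda>n. (\<chi> j. n $ j div 2, \<chi> j. odd (n $ j))) (dyadic_child x) = x"
    by (cases x) (auto simp: dyadic_child_def vec_eq_iff)
next
  fix n :: "int ^ 'm"
  show "dyadic_child ((\<lambda>n. (\<chi> j. n $ j div 2, \<chi> j. odd (n $ j))) n) = n"
    by (auto simp: dyadic_child_def vec_eq_iff of_bool_def)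
qed auto

lemma dyadic_child_subset: "dyadic_cube (Suc k) (dyadic_child (n, e)) \<subseteq> dyadic_cube k n"
proof
  fix p
  assume p: "p \<in> dyadic_cube (Suc k) (dyadic_child (n, e))"
  have "\<lfloor>2 ^ k * p $ j\<rfloor> = n $ j" for j
  proof -
    have "\<lfloor>2 * (2 ^ k * p $ j)\<rfloor> = 2 * n $ j + of_bool (e $ j)"
      using p by (simp add: mem_dyadic_cube_iff dyadic_child_def mult.assoc)
    then show ?thesis
      by (cases "e $ j") (simp_all, linarith+)
  qed
  then show "p \<in> dyadic_cube k n"
    by (simp add: mem_dyadic_cube_iff)
qed

section \<open>Upper and lower sums\<close>

lemma BB_lincomb:
  fixes f g :: "real ^ 'm \<Rightarrow> real"
  assumes f: "f \<in> BB" and g: "g \<in> BB"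
  shows "(\<lambda>x. a * f x + b * g x) \<in> BB"
proof -
  obtain A B where A: "\<And>x. \<bar>f x\<bar> \<le> A" and B: "\<And>x. \<bar>g x\<bar> \<le> B"
    using f g by (auto simp: BB_def bounded_iff)
  have "\<bar>a * f x + b * g x\<bar> \<le> \<bar>a\<bar> * A + \<bar>b\<bar> * B" for x
  proof -
    have "\<bar>a * f x + b * g x\<bar> \<le> \<bar>a\<bar> * \<bar>f x\<bar> + \<bar>b\<bar> * \<bar>g x\<bar>"
      by (metis abs_mult abs_triangle_ineq)
    also have "\<dots> \<le> \<bar>a\<bar> * A + \<bar>b\<bar> * B"
      by (intro add_mono mult_left_mono A B) auto
    finally show ?thesis .
  qed
  then have "bounded (range (\<lambda>x. a * f x + b * g x))"
    by (auto simp: bounded_iff)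
  moreover obtain S T where "bounded S" "bounded T"
    and "\<And>x. x \<notin> S \<Longrightarrow> f x = 0" "\<And>x. x \<notin> T \<Longrightarrow> g x = 0"
    using f g by (auto simp: BB_def)
  then have "bounded (S \<union> T)" "\<forall>x. x \<notin> S \<union> T \<longrightarrow> a * f x + b * g x = 0"
    by auto
  ultimately show ?thesis
    unfolding BB_def by blast
qed

lemma BB_uminus: "f \<in> BB \<Longrightarrow> (\<lambda>x. - f x) \<in> BB"
  using BB_lincomb[of f f "-1" 0] by simp

lemma BB_bdd_above: "f \<in> BB \<Longrightarrow> bdd_above (f ` I)"
  by (metis (mono_tags, lifting) BB_def bdd_above_mono bounded_imp_bdd_above image_mono
      mem_Collect_eq top_greatest)

lemma BB_bdd_below: "f \<in> BB \<Longrightarrow> bdd_below (f ` I)"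
  by (metis (mono_tags, lifting) BB_def bdd_below_mono bounded_imp_bdd_below image_mono
      mem_Collect_eq top_greatest)

lemma finite_nonzero_dyadic_SUP:
  fixes f :: "real ^ 'm \<Rightarrow> real"
  assumes "f \<in> BB"
  shows "finite {n. (SUP p\<in>dyadic_cube k n. f p) \<noteq> 0}"
proof -
  obtain S where S: "bounded S" "\<And>x. x \<notin> S \<Longrightarrow> f x = 0"
    using assms by (auto simp: BB_def)
  have "(SUP p\<in>dyadic_cube k n. f p) = 0" if "dyadic_cube k n \<inter> S = {}" for n
  proof -
    have "(SUP p\<in>dyadic_cube k n. f p) = (SUP p\<in>dyadic_cube k n. 0)"
      using S(2) that by (intro SUP_cong) auto
    then show ?thesis
      by (simp add: dyadic_cube_nonempty)
  qed
  then have "{n. (SUP p\<in>dyadic_cube k n. f p) \<noteq> 0} \<subseteq> {n. dyadic_cube k n \<inter> S \<noteq> {}}"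
    by auto
  then show ?thesis
    by (rule finite_subset[OF _ finite_dyadic_cubes_meeting_bounded[OF S(1)]])
qed

lemma summable_dyadic_SUP:
  fixes f :: "real ^ 'm \<Rightarrow> real"
  assumes "f \<in> BB"
  shows "(\<lambda>n. SUP p\<in>dyadic_cube k n. f p) summable_on UNIV"
  using finite_nonzero_dyadic_SUP[OF assms] by (intro finite_nonzero_values_imp_summable_on) simp

lemma upper_sum_eq_infsum_index:
  fixes f :: "real ^ 'm \<Rightarrow> real"
  shows "upper_sum k f =
    (1/2) ^ (k * CARD('m)) * (\<Sum>\<^sub>\<infinity>n. SUP p\<in>dyadic_cube k n. f p)"
  by (simp add: upper_sum_def dyadic_cubes_def infsum_reindex[OF inj_dyadic_cube] o_def)

lemma lower_sum_eq_infsum_index: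
  fixes f :: "real ^ 'm \<Rightarrow> real"
  shows "lower_sum k f =
    (1/2) ^ (k * CARD('m)) * (\<Sum>\<^sub>\<infinity>n. INF p\<in>dyadic_cube k n. f p)"
  by (simp add: lower_sum_def dyadic_cubes_def infsum_reindex[OF inj_dyadic_cube] o_def)

text \<open>With this duality every statement about lower sums follows from one about upper sums.\<close>

lemma lower_sum_eq_uminus_upper_sum:
  "lower_sum k f = - upper_sum k (\<lambda>x. - f x)"
  by (simp add: lower_sum_def upper_sum_def Inf_real_def image_image infsum_uminus)

lemma lower_sum_le_upper_sum:
  fixes f :: "real ^ 'm \<Rightarrow> real"
  assumes f: "f \<in> BB"
  shows "lower_sum k f \<le> upper_sum k f"
  unfolding lower_sum_eq_infsum_index upper_sum_eq_infsum_index
proof (intro mult_left_mono infsum_mono summable_dyadic_SUP f)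
  show "(\<lambda>n. INF p\<in>dyadic_cube k n. f p) summable_on UNIV"
    using summable_dyadic_SUP[OF BB_uminus[OF f], of k]
    by (simp add: Inf_real_def image_image summable_on_uminus)
  show "(INF p\<in>dyadic_cube k n. f p) \<le> (SUP p\<in>dyadic_cube k n. f p)" for n
    using dyadic_cube_nonempty[of k n]
    by (meson BB_bdd_above BB_bdd_below cINF_lower cSUP_upper ex_in_conv f order_trans)
qed simp

text \<open>The supremum over a child is at most that over its parent, and summing this over the
  \<open>2 ^ m\<close> children of each cube is offset by the ratio of the volume factors.\<close>

lemma decseq_upper_sum:
  fixes f :: "real ^ 'm \<Rightarrow> real"
  assumes f: "f \<in> BB"
  shows "decseq (\<lambda>k. upper_sum k f)"
proof (rule decseq_SucI)
  fix k
  let ?s = "\<lambda>k n. SUP p\<in>dyadic_cube k n. f p"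
  have summable_children: "(\<lambda>x. ?s (Suc k) (dyadic_child x)) summable_on UNIV \<times> UNIV"
    using summable_dyadic_SUP[OF f, of "Suc k"]
    by (simp only: UNIV_Times_UNIV
        summable_on_reindex_bij_betw[OF bij_dyadic_child, of "?s (Suc k)"])
  have "(\<Sum>\<^sub>\<infinity>n. ?s (Suc k) n) = (\<Sum>\<^sub>\<infinity>x\<in>UNIV \<times> UNIV. ?s (Suc k) (dyadic_child x))"
    using infsum_reindex_bij_betw[OF bij_dyadic_child, of "?s (Suc k)"]
    by simp
  also have "\<dots> = (\<Sum>\<^sub>\<infinity>n. \<Sum>\<^sub>\<infinity>e. ?s (Suc k) (dyadic_child (n, e)))"
    by (rule infsum_Sigma_banach[symmetric]) (fact summable_children)
  also have "\<dots> \<le> (\<Sum>\<^sub>\<infinity>n. 2 ^ CARD('m) * ?s k n)"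
  proof (rule infsum_mono)
    show "(\<lambda>n. \<Sum>\<^sub>\<infinity>e. ?s (Suc k) (dyadic_child (n, e))) summable_on UNIV"
      by (rule summable_on_Sigma_banach)
        (use summable_children in \<open>simp only: case_prod_unfold prod.collapse\<close>)
    show "(\<lambda>n. 2 ^ CARD('m) * ?s k n) summable_on UNIV"
      by (intro summable_on_cmult_right summable_dyadic_SUP f)
    fix n :: "int ^ 'm"
    have "(\<Sum>e\<in>UNIV. ?s (Suc k) (dyadic_child (n, e))) \<le> (\<Sum>e\<in>(UNIV :: (bool ^ 'm) set). ?s k n)"
      by (intro sum_mono cSUP_subset_mono dyadic_child_subset dyadic_cube_nonempty
          BB_bdd_above f) simp
    then show "(\<Sum>\<^sub>\<infinity>e. ?s (Suc k) (dyadic_child (n, e))) \<le> 2 ^ CARD('m) * ?s k n"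
      by simp
  qed
  also have "\<dots> = 2 ^ CARD('m) * (\<Sum>\<^sub>\<infinity>n. ?s k n)"
    by (rule infsum_cmult_right')
  finally have "upper_sum (Suc k) f
    \<le> (1/2) ^ (Suc k * CARD('m)) * (2 ^ CARD('m) * (\<Sum>\<^sub>\<infinity>n. ?s k n))"
    unfolding upper_sum_eq_infsum_index by (rule mult_left_mono) simp
  also have "\<dots> = upper_sum k f"
    by (simp add: upper_sum_eq_infsum_index power_add power_one_over)
  finally show "upper_sum (Suc k) f \<le> upper_sum k f" .
qed

lemma incseq_lower_sum:
  fixes f :: "real ^ 'm \<Rightarrow> real"
  assumes "f \<in> BB"
  shows "incseq (\<lambda>k. lower_sum k f)"
  using decseq_upper_sum[OF BB_uminus[OF assms]]
  by (simp add: lower_sum_eq_uminus_upper_sum incseq_def decseq_def)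

lemma convergent_upper_sum:
  fixes f :: "real ^ 'm \<Rightarrow> real"
  assumes f: "f \<in> BB"
  shows "convergent (\<lambda>k. upper_sum k f)"
proof -
  have "lower_sum 0 f \<le> upper_sum k f" for k
    using incseqD[OF incseq_lower_sum[OF f], of 0 k] lower_sum_le_upper_sum[OF f, of k]
    by simp
  then show ?thesis
    using decseq_convergent[OF decseq_upper_sum[OF f]] by (metis convergentI)
qed

lemma convergent_lower_sum:
  fixes f :: "real ^ 'm \<Rightarrow> real"
  assumes "f \<in> BB"
  shows "convergent (\<lambda>k. lower_sum k f)"
  using convergent_upper_sum[OF BB_uminus[OF assms]]
  by (simp add: lower_sum_eq_uminus_upper_sum flip: convergent_minus_iff)

lemma upper_sum_sublinear:
  fixes f g :: "real ^ 'm \<Rightarrow> real"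
  assumes f: "f \<in> BB" and g: "g \<in> BB" and a: "0 \<le> a" and b: "0 \<le> b"
  shows "upper_sum k (\<lambda>x. a * f x + b * g x) \<le> a * upper_sum k f + b * upper_sum k g"
proof -
  let ?s = "\<lambda>f n. SUP p\<in>dyadic_cube k n. f p"
  have summable: "(\<lambda>n. c * ?s h n) summable_on UNIV" if "h \<in> BB" for h :: "real ^ 'm \<Rightarrow> real" and c
    by (intro summable_on_cmult_right summable_dyadic_SUP that)
  have "(\<Sum>\<^sub>\<infinity>n. ?s (\<lambda>x. a * f x + b * g x) n) \<le> (\<Sum>\<^sub>\<infinity>n. a * ?s f n + b * ?s g n)"
  proof (intro infsum_mono summable_dyadic_SUP summable_on_add summable BB_lincomb f g)
    fix n
    show "?s (\<lambda>x. a * f x + b * g x) n \<le> a * ?s f n + b * ?s g n"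
      by (intro cSUP_least dyadic_cube_nonempty add_mono mult_left_mono cSUP_upper
          BB_bdd_above f g a b)
  qed
  also have "\<dots> = a * (\<Sum>\<^sub>\<infinity>n. ?s f n) + b * (\<Sum>\<^sub>\<infinity>n. ?s g n)"
    by (simp add: infsum_add summable f g infsum_cmult_right')
  finally have "upper_sum k (\<lambda>x. a * f x + b * g x)
    \<le> (1/2) ^ (k * CARD('m)) * (a * (\<Sum>\<^sub>\<infinity>n. ?s f n) + b * (\<Sum>\<^sub>\<infinity>n. ?s g n))"
    unfolding upper_sum_eq_infsum_index by (rule mult_left_mono) simp
  also have "\<dots> = a * upper_sum k f + b * upper_sum k g"
    by (simp add: upper_sum_eq_infsum_index algebra_simps)
  finally show ?thesis .
qed

lemma lower_sum_superlinear:
  fixes f g :: "real ^ 'm \<Rightarrow> real"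
  assumes "f \<in> BB" "g \<in> BB" "0 \<le> a" "0 \<le> b"
  shows "a * lower_sum k f + b * lower_sum k g \<le> lower_sum k (\<lambda>x. a * f x + b * g x)"
  using upper_sum_sublinear[OF BB_uminus BB_uminus, OF assms, of k]
  by (simp add: lower_sum_eq_uminus_upper_sum)

section \<open>The integral as a common limit\<close>

text \<open>Unlike an equation between values of \<open>lim\<close>, this relation asserts convergence, so that it
  composes with limit theorems.\<close>

definition has_dyadic_integral :: "(real ^ 'm \<Rightarrow> real) \<Rightarrow> real \<Rightarrow> bool" where
  "has_dyadic_integral f c \<longleftrightarrow> f \<in> BB \<and>
     (\<lambda>k. upper_sum k f) \<longlonglongrightarrow> c \<and> (\<lambda>k. lower_sum k f) \<longlonglongrightarrow> c"

lemma has_dyadic_integral_iff: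
  fixes f :: "real ^ 'm \<Rightarrow> real"
  shows "has_dyadic_integral f c \<longleftrightarrow> f \<in> RI \<and> dyadic_integral f = c"
proof
  assume "has_dyadic_integral f c"
  then show "f \<in> RI \<and> dyadic_integral f = c"
    by (auto simp: has_dyadic_integral_def RI_def dyadic_integral_def limI)
next
  assume "f \<in> RI \<and> dyadic_integral f = c"
  then have f: "f \<in> BB" "lim (\<lambda>k. upper_sum k f) = c" "lim (\<lambda>k. lower_sum k f) = c"
    by (auto simp: RI_def dyadic_integral_def)
  then show "has_dyadic_integral f c"
    using convergent_upper_sum[OF f(1)] convergent_lower_sum[OF f(1)]
    by (simp add: has_dyadic_integral_def convergent_LIMSEQ_iff)
qed

lemma has_dyadic_integral_uminus:
  fixes f :: "real ^ 'm \<Rightarrow> real"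
  assumes "has_dyadic_integral f c"
  shows "has_dyadic_integral (\<lambda>x. - f x) (- c)"
proof -
  have f: "f \<in> BB" "(\<lambda>k. upper_sum k f) \<longlonglongrightarrow> c" "(\<lambda>k. - upper_sum k (\<lambda>x. - f x)) \<longlonglongrightarrow> c"
    using assms by (simp_all add: has_dyadic_integral_def lower_sum_eq_uminus_upper_sum)
  from tendsto_minus[OF f(2)] tendsto_minus[OF f(3)] BB_uminus[OF f(1)]
  show ?thesis
    by (simp add: has_dyadic_integral_def lower_sum_eq_uminus_upper_sum)
qed

lemma has_dyadic_integral_nonneg_lincomb:
  fixes f g :: "real ^ 'm \<Rightarrow> real"
  assumes "has_dyadic_integral f c" "has_dyadic_integral g d" and ab: "0 \<le> a" "0 \<le> b"
  shows "has_dyadic_integral (\<lambda>x. a * f x + b * g x) (a * c + b * d)"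
proof -
  let ?h = "\<lambda>x. a * f x + b * g x"
  have f: "f \<in> BB" and g: "g \<in> BB"
    using assms by (auto simp: has_dyadic_integral_def)
  have h: "?h \<in> BB"
    by (rule BB_lincomb[OF f g])
  have upper: "(\<lambda>k. a * upper_sum k f + b * upper_sum k g) \<longlonglongrightarrow> a * c + b * d"
    and lower: "(\<lambda>k. a * lower_sum k f + b * lower_sum k g) \<longlonglongrightarrow> a * c + b * d"
    using assms unfolding has_dyadic_integral_def by (auto intro!: tendsto_intros)
  note bounds = lower_sum_superlinear[OF f g ab] lower_sum_le_upper_sum[OF h]
    upper_sum_sublinear[OF f g ab]
  have "(\<lambda>k. upper_sum k ?h) \<longlonglongrightarrow> a * c + b * d"
    by (rule tendsto_sandwich[OF _ _ lower upper])
      (intro always_eventually allI order_trans[OF bounds(1,2)] bounds(3))+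
  moreover have "(\<lambda>k. lower_sum k ?h) \<longlonglongrightarrow> a * c + b * d"
    by (rule tendsto_sandwich[OF _ _ lower upper])
      (intro always_eventually allI order_trans[OF bounds(2,3)] bounds(1))+
  ultimately show ?thesis
    using h by (simp add: has_dyadic_integral_def)
qed

theorem theorem4p6:
  fixes f g :: "real ^ 'm \<Rightarrow> real" and \<alpha> \<beta> :: real
  assumes "f \<in> RI" and "g \<in> RI"
  shows "(\<lambda>x. \<alpha> * f x + \<beta> * g x) \<in> RI \<and>
         dyadic_integral (\<lambda>x. \<alpha> * f x + \<beta> * g x) =
           \<alpha> * dyadic_integral f + \<beta> * dyadic_integral g"
proof -
  \<comment> \<open>Writing \<open>a\<close> as \<open>\<bar>a\<bar>\<close> times a sign moves that sign into the function and leaves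
    nonnegative coefficients. The sign is 1 at 0, unlike \<open>sgn\<close>, so that it is always a
    unit.\<close>
  have signed: "has_dyadic_integral (\<lambda>x. (if 0 \<le> a then 1 else -1) * h x)
      ((if 0 \<le> a then 1 else -1) * dyadic_integral h)"
    if "h \<in> RI" for a :: real and h :: "real ^ 'm \<Rightarrow> real"
    using that has_dyadic_integral_uminus[of h "dyadic_integral h"]
    by (simp add: has_dyadic_integral_iff)
  have abs_mult_sign: "\<bar>a\<bar> * ((if 0 \<le> a then 1 else -1) * y) = a * y" for a y :: real
    by simp
  then have "has_dyadic_integral (\<lambda>x. \<alpha> * f x + \<beta> * g x)
      (\<alpha> * dyadic_integral f + \<beta> * dyadic_integral g)"
    using has_dyadic_integral_nonneg_lincomb[OF signed[OF assms(1), of \<alpha>]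
        signed[OF assms(2), of \<beta>], of "\<bar>\<alpha>\<bar>" "\<bar>\<beta>\<bar>"]
    by (simp only: abs_mult_sign abs_ge_zero)
  then show ?thesis
    by (simp add: has_dyadic_integral_iff)
qed

end
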